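(* Let $x,y$ be real numbers in a neighborhood of $1$ (that is, the following holds for all $x,y$ in some neighborhood of $1$ in $\mathbb{R}$ satisfying one of the listed cases). Then $$3\sum_{n=0}^\infty\frac{\left(\frac13\right)_n\left(\frac23\right)_n}{(n!)^2}\,P_{3n}\!\left(\frac{x+y-2x^2y^2}{(x-y)\sqrt{1+4xy(x+y)}}\right)\left(\frac{x-y}{\sqrt{1+4xy(x+y)}}\right)^{3n}$$ is equal to $$\sqrt{1+4xy(x+y)}\cdot\begin{cases} 1 & \text{if } x=y=1,\\ P_{-1/3}(2x^3-1)\,P_{-1/3}(2y^3-1) & \text{if } x,y>1,\\ \mathrm{P}_{-1/3}(2x^3-1)\,P_{-1/3}(2y^3-1) & \text{if } x<1\text{ and }y>1,\\ P_{-1/3}(2x^3-1)\,\mathrm{P}_{-1/3}(2y^3-1) & \text{if } x>1\text{ and }y<1,\\ \mathrm{P}_{-1/3}(2x^3-1)\,\mathrm{P}_{-1/3}(2y^3-1) & \text{if } x,y<1. \end{cases}$$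
   Context: $(z)_n=\prod_{i=1}^n(z+i-1)$ is the Pochhammer symbol. ${}_2F_1$ is the Gauss hypergeometric function, analytically continued to $\mathbb{C}\setminus[1,\infty)$. For $n\in\{0,1,2,\dots\}$, $P_n(z)={}_2F_1(-n,n+1;1;\frac{1-z}{2})$ is the Legendre polynomial. The Legendre function of the first kind $P_\nu(z)$ (italic, argument in $\mathbb{C}\setminus(-\infty,1]$) and the Ferrers function of the first kind of order zero $\mathrm{P}_\nu(x)$ (roman, argument in $(-1,1)$) are both given by the formula ${}_2F_1(-\nu,\nu+1;1;\frac{1-z}{2})$. When $x=y$, each summand is understood as its continuous extension: $P_{3n}(A/B)B^{3n}$ is a polynomial in $A,B$, evaluated at the limiting values, with $B=\frac{x-y}{\sqrt{1+4xy(x+y)}}$ and $A=\frac{x+y-2x^2y^2}{1+4xy(x+y)}$. *)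

theory Defs
  imports
    "HOL-Complex_Analysis.Complex_Analysis"
    "HOL-Library.Nonpos_Ints"
begin

definition hyp2F1_series :: "complex \<Rightarrow> complex \<Rightarrow> complex \<Rightarrow> complex \<Rightarrow> complex" where
  "hyp2F1_series a b c z =
     (\<Sum>k. pochhammer a k * pochhammer b k / (pochhammer c k * fact k) * z ^ k)"

text \<open>
  The series converges in the open unit disc, and it terminates (hence is a polynomial in
  \<open>z\<close>, with no cut) if \<open>a\<close> or \<open>b\<close> is a nonpositive integer.
  In all other cases the value is that of the analytic continuation to the complex plane
  without \<open>[1, \<infinity>)\<close>. The description operator is applied to the value and not to the
  continuation itself, since the latter is determined only on the slit plane.
  Nothing is claimed about \<open>z \<in> [1, \<infinity>)\<close> for non-terminating series.
\<close>

definition slit_plane :: "complex set" where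
  "slit_plane = - (complex_of_real ` {1..})"

definition hyp2F1 :: "complex \<Rightarrow> complex \<Rightarrow> complex \<Rightarrow> complex \<Rightarrow> complex" where
  "hyp2F1 a b c z =
     (if norm z < 1 \<or> a \<in> \<int>\<^sub>\<le>\<^sub>0 \<or> b \<in> \<int>\<^sub>\<le>\<^sub>0 then hyp2F1_series a b c z
      else (THE w. \<exists>f. f holomorphic_on slit_plane \<and>
                       (\<forall>u\<in>ball 0 1. f u = hyp2F1_series a b c u) \<and> w = f z))"

text \<open>The value selected above is that of any analytic continuation of the series.\<close>

lemma hyp2F1_eq_continuation:
  assumes f: "f holomorphic_on slit_plane"
    and fs: "\<And>u. u \<in> ball 0 1 \<Longrightarrow> f u = hyp2F1_series a b c u"
    and ab: "a \<notin> \<int>\<^sub>\<le>\<^sub>0" "b \<notin> \<int>\<^sub>\<le>\<^sub>0"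
    and z: "z \<in> slit_plane"
  shows "hyp2F1 a b c z = f z"
proof (cases "norm z < 1")
  case True
  then show ?thesis using fs by (simp add: hyp2F1_def)
next
  case False
  have conn: "connected slit_plane"
    unfolding slit_plane_def
    by (intro starlike_imp_connected starlike_slotted_complex_plane_right)
  have op: "open slit_plane"
    unfolding slit_plane_def
    by (intro open_Compl closed_slot_right)
  have sub: "ball 0 1 \<subseteq> slit_plane"
    by (auto simp: slit_plane_def)
  have uniq: "g z = f z"
    if g: "g holomorphic_on slit_plane" and gs: "\<forall>u\<in>ball 0 1. g u = hyp2F1_series a b c u" for g
  proof (rule analytic_continuation_open[OF _ op _ conn sub g f _ z])
    show "g u = f u" if "u \<in> ball 0 1" for u
      using that gs fs by metis
  qed auto
  have "(THE w. \<exists>g. g holomorphic_on slit_plane \<and>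
                    (\<forall>u\<in>ball 0 1. g u = hyp2F1_series a b c u) \<and> w = g z) = f z"
  proof (rule the_equality)
    show "\<exists>g. g holomorphic_on slit_plane \<and>
             (\<forall>u\<in>ball 0 1. g u = hyp2F1_series a b c u) \<and> f z = g z"
      using f fs by blast
  qed (blast dest: uniq)
  with False ab show ?thesis by (simp add: hyp2F1_def)
qed

definition legendre_poly :: "nat \<Rightarrow> complex \<Rightarrow> complex" where
  "legendre_poly n z = hyp2F1 (- of_nat n) (of_nat n + 1) 1 ((1 - z) / 2)"

text \<open>
  Legendre function of the first kind; meaningful for \<open>z\<close> outside \<open>(-\<infinity>, 1]\<close>.
\<close>

definition legendre_fun :: "complex \<Rightarrow> complex \<Rightarrow> complex" where
  "legendre_fun \<nu> z = hyp2F1 (- \<nu>) (\<nu> + 1) 1 ((1 - z) / 2)"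

text \<open>
  Ferrers function of the first kind of order zero; meaningful for \<open>-1 < x < 1\<close>.
\<close>

definition ferrers_fun :: "complex \<Rightarrow> real \<Rightarrow> complex" where
  "ferrers_fun \<nu> x = hyp2F1 (- \<nu>) (\<nu> + 1) 1 ((1 - complex_of_real x) / 2)"

definition legendre_factor_offdiag :: "nat \<Rightarrow> real \<Rightarrow> real \<Rightarrow> complex" where
  "legendre_factor_offdiag m x y =
     legendre_poly m (complex_of_real
       ((x + y - 2 * x\<^sup>2 * y\<^sup>2) / ((x - y) * sqrt (1 + 4 * x * y * (x + y))))) *
     complex_of_real ((x - y) / sqrt (1 + 4 * x * y * (x + y))) ^ m"

text \<open>
  With \<open>B = (x - y) / sqrt (1 + 4 x y (x + y))\<close> and
  \<open>A = (x + y - 2 x\<^sup>2 y\<^sup>2) / (1 + 4 x y (x + y))\<close>, the off-diagonal factor is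
  \<open>P\<^sub>m(A / B) B\<^sup>m\<close>, a polynomial in \<open>A\<close> and \<open>B\<close>. On the diagonal, where \<open>B = 0\<close>,
  it is replaced by its limit, i.e. by its continuous extension.
\<close>

definition legendre_factor :: "nat \<Rightarrow> real \<Rightarrow> real \<Rightarrow> complex" where
  "legendre_factor m x y =
     (if x \<noteq> y then legendre_factor_offdiag m x y
      else Lim (at (x, y) within {(u, v). u \<noteq> v}) (\<lambda>(u, v). legendre_factor_offdiag m u v))"

end

theory Submission
  imports Defs
begin

text \<open>
  Put \<open>D = 1 + 4 x y (x + y)\<close> and let \<open>h\<^sub>n(x, y)\<close> be \<open>D\<^sup>-\<^sup>1\<^sup>/\<^sup>2 P\<^sub>n(A / B) B\<^sup>n\<close> in the notation of the
  theorem. The generating function of the Legendre polynomials gives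
  \<open>\<Sum>n. h\<^sub>n t\<^sup>n = R\<^sup>-\<^sup>1\<^sup>/\<^sup>2\<close> with \<open>R(x, y, t) = D - 2 (x + y - 2 x\<^sup>2 y\<^sup>2) t + (x - y)\<^sup>2 t\<^sup>2\<close>. Now
  \<open>t\<^sup>2 R(x, y, 1/t) = x\<^sup>2 + y\<^sup>2 + t\<^sup>2 - 2 (x y + x t + y t) + 4 x y t (x y + x t + y t)\<close>
  is symmetric in all three variables, and its inverse square root \<open>K\<close> is a kernel for the
  operator \<open>L f = (x (1 - x\<^sup>3) f')' - 2 x\<^sup>2 f\<close>: applying \<open>L\<close> to \<open>K\<close> in \<open>x\<close>, in \<open>y\<close> or in \<open>t\<close>
  gives the same result. This operator annihilates
  \<open>f(x) = \<^sub>2F\<^sub>1(1/3, 2/3; 1; 1 - x\<^sup>3)\<close>, which is \<open>P\<^sub>\<nu>(2 x\<^sup>3 - 1)\<close> for \<open>\<nu> = -1/3\<close>, and also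
  \<open>\<^sub>2F\<^sub>1(1/3, 2/3; 1; t\<^sup>3)\<close>, the generating function of the coefficients of the series.

  In terms of coefficients (\<open>cubic_op_legendre_kernel\<close>) the kernel property says
  \<open>L h\<^sub>n = n\<^sup>2 h\<^sub>n\<^sub>-\<^sub>1 - (n + 1) (n + 2) h\<^sub>n\<^sub>+\<^sub>2\<close>, and therefore \<open>L\<close> applied to \<open>\<Sum>n. c\<^sub>n h\<^sub>3\<^sub>n\<close> with
  \<open>c\<^sub>n = (1/3)\<^sub>n (2/3)\<^sub>n / (n!)\<^sup>2\<close> telescopes to 0 (\<open>cubic_op_series_eq_0\<close>). The same lemma shows
  \<open>L f = 0\<close>. Near the singular point 1 a holomorphic solution is determined by its value at 1
  (\<open>cubic_op_unique\<close>). So the sum is a multiple of \<open>f(x)\<close> for each \<open>y\<close> and, being symmetric, equals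
  \<open>f(x) f(y)\<close> times its value \<open>1/3\<close> at \<open>(1, 1)\<close>. Multiplying by \<open>3 D\<^sup>1\<^sup>/\<^sup>2\<close> gives the theorem. Near 1 all
  hypergeometric arguments lie in the unit disc, where Legendre and Ferrers functions are given
  by one power series, so the five cases coincide.
\<close>

section \<open>The cubic hypergeometric operator and telescoping series\<close>

definition cubic_coeff :: "nat \<Rightarrow> complex" where
  "cubic_coeff n = pochhammer (1/3) n * pochhammer (2/3) n / (fact n)\<^sup>2"

lemma cubic_coeff_0 [simp]: "cubic_coeff 0 = 1"
  by (simp add: cubic_coeff_def)

text \<open>
  The ratio of consecutive coefficients, cleared of denominators. Both telescoping arguments
  below consist in cancelling the two sides of this identity.
\<close>

lemma cubic_coeff_Suc:
  "9 * (of_nat n + 1)\<^sup>2 * cubic_coeff (Suc n)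
     = (3 * of_nat n + 1) * (3 * of_nat n + 2) * cubic_coeff n"
proof -
  have nz: "(of_nat n + 1 :: complex) \<noteq> 0"
    by (metis of_nat_Suc of_nat_neq_0 add.commute)
  show ?thesis
    unfolding cubic_coeff_def pochhammer_Suc fact_Suc
    using nz by (simp add: divide_simps) (simp add: algebra_simps power2_eq_square)
qed

lemma norm_cubic_coeff_le_1: "norm (cubic_coeff n) \<le> 1"
proof (induction n)
  case (Suc n)
  have "9 * (real n + 1)\<^sup>2 * norm (cubic_coeff (Suc n))
          = norm (9 * (of_nat n + 1)\<^sup>2 * cubic_coeff (Suc n))"
    using norm_of_nat[of "Suc n", where 'a = complex]
    by (simp add: norm_mult norm_power add.commute)
  also have "\<dots> = norm (of_nat ((3 * n + 1) * (3 * n + 2)) * cubic_coeff n)"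
    unfolding cubic_coeff_Suc by (simp add: algebra_simps)
  also have "\<dots> = real ((3 * n + 1) * (3 * n + 2)) * norm (cubic_coeff n)"
    by (simp only: norm_mult norm_of_nat)
  also have "\<dots> \<le> real ((3 * n + 1) * (3 * n + 2))"
    using Suc by (intro mult_left_le) auto
  also have "\<dots> \<le> 9 * (real n + 1)\<^sup>2"
    by (simp add: power2_eq_square algebra_simps)
  finally show ?case by simp
qed simp

text \<open>
  The hypergeometric operator with parameters \<open>1/3, 2/3; 1\<close> in the variable \<open>1 - x\<^sup>3\<close>,
  up to a factor. It has the self-adjoint form
  \<open>f \<mapsto> (x (1 - x\<^sup>3) f')' - 2 x\<^sup>2 f\<close>.
\<close>

definition cubic_op :: "(complex \<Rightarrow> complex) \<Rightarrow> complex \<Rightarrow> complex" where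
  "cubic_op f x = x * (1 - x ^ 3) * deriv (deriv f) x + (1 - 4 * x ^ 3) * deriv f x - 2 * x\<^sup>2 * f x"

lemma cubic_op_sum:
  assumes S: "open S" "x \<in> S" and g: "\<And>n. g n holomorphic_on S"
  shows "cubic_op (\<lambda>x. \<Sum>n<N. c n * g n x) x = (\<Sum>n<N. c n * cubic_op (g n) x)"
proof -
  have d1: "deriv (\<lambda>x. \<Sum>n<N. c n * g n x) z = (\<Sum>n<N. c n * deriv (g n) z)" if "z \<in> S" for z
    by (rule DERIV_imp_deriv)
       (auto intro!: derivative_eq_intros holomorphic_derivI[OF g S(1) that] simp: mult.commute)
  have "deriv (deriv (\<lambda>x. \<Sum>n<N. c n * g n x)) x = deriv (\<lambda>z. \<Sum>n<N. c n * deriv (g n) z) x"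
    by (rule deriv_cong_ev) (use d1 eventually_nhds_in_open[OF S] in \<open>auto elim: eventually_mono\<close>)
  also have "\<dots> = (\<Sum>n<N. c n * deriv (deriv (g n)) x)"
    by (rule DERIV_imp_deriv)
       (auto intro!: derivative_eq_intros holomorphic_derivI[OF holomorphic_deriv[OF g S(1)] S]
          simp: mult.commute)
  finally show ?thesis
    unfolding cubic_op_def
    by (simp add: d1[OF S(2)] sum_distrib_left sum.distrib sum_subtractf algebra_simps)
qed

text \<open>
  If the operator sends each \<open>g n\<close> to a difference of two members of a second sequence
  \<open>k\<close>, weighted as in \<open>op\<close>, then by the ratio of the coefficients only one boundary term
  is left of the operator applied to a partial sum, and it tends to 0. Since a locally uniform
  limit of holomorphic functions may be differentiated twice under the limit, the whole sum is
  annihilated. Both sides of the main identity are treated by this one lemma.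
\<close>

lemma cubic_op_series_eq_0:
  assumes S: "open S"
    and hol: "\<And>n. g n holomorphic_on S"
    and op: "\<And>n x. x \<in> S \<Longrightarrow> cubic_op (g n) x
               = 9 * (of_nat n)\<^sup>2 * k n x - (3 * of_nat n + 1) * (3 * of_nat n + 2) * k (Suc n) x"
    and bg: "\<And>n x. x \<in> S \<Longrightarrow> norm (g n x) \<le> C * (1/2) ^ n"
    and bk: "\<And>n x. x \<in> S \<Longrightarrow> norm (k n x) \<le> C * (1/2) ^ n"
  defines "G \<equiv> \<lambda>x. \<Sum>n. cubic_coeff n * g n x"
  shows "G holomorphic_on S" and "\<And>x. x \<in> S \<Longrightarrow> cubic_op G x = 0"
    and "\<And>x. x \<in> S \<Longrightarrow> summable (\<lambda>n. cubic_coeff n * g n x)"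
proof -
  define s where "s = (\<lambda>N x. \<Sum>n<N. cubic_coeff n * g n x)"
  have term_le: "norm (cubic_coeff n * f) \<le> C * (1/2) ^ n" if "norm f \<le> C * (1/2) ^ n" for n f
    using mult_mono[OF norm_cubic_coeff_le_1 that] by (simp add: norm_mult)
  have geo: "summable (\<lambda>n. C * (1/2) ^ n)"
    by (intro summable_mult summable_geometric) simp
  have unif: "uniform_limit S s G sequentially"
    unfolding s_def G_def by (rule Weierstrass_m_test[OF _ geo]) (use bg term_le in blast)
  have hol_s: "s N holomorphic_on S" for N
    unfolding s_def by (intro holomorphic_intros hol)
  show hol_G: "G holomorphic_on S"
  proof (rule holomorphic_uniform_sequence[OF S hol_s])
    fix x assume "x \<in> S"
    then obtain d where d: "d > 0" "cball x d \<subseteq> S"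
      using S open_contains_cball by blast
    with unif show "\<exists>d>0. cball x d \<subseteq> S \<and> uniform_limit (cball x d) s G sequentially"
      by (meson uniform_limit_on_subset)
  qed
  fix x assume x: "x \<in> S"
  show "summable (\<lambda>n. cubic_coeff n * g n x)"
    by (rule summable_comparison_test'[OF geo]) (use bg[OF x] term_le in blast)
  have lim: "(\<lambda>N. (deriv ^^ m) (s N) x) \<longlonglongrightarrow> (deriv ^^ m) G x" for m
    by (rule higher_deriv_complex_uniform_limit[OF unif _ _ S x]) (simp_all add: hol_s)
  have "(\<lambda>N. cubic_op (s N) x) \<longlonglongrightarrow> cubic_op G x"
    unfolding cubic_op_def using lim[of 0] lim[of 1] lim[of 2]
    by (intro tendsto_intros) (simp_all add: numeral_2_eq_2)
  \<comment> \<open>telescoping leaves only the boundary term\<close>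
  moreover have tel: "cubic_op (s N) x = - (9 * (of_nat N)\<^sup>2 * (cubic_coeff N * k N x))" for N
  proof -
    have "cubic_op (s N) x = (\<Sum>n<N. cubic_coeff n * cubic_op (g n) x)"
      unfolding s_def by (rule cubic_op_sum[OF S x hol])
    also have "\<dots> = (\<Sum>n<N. - (9 * (of_nat (Suc n))\<^sup>2 * (cubic_coeff (Suc n) * k (Suc n) x))
                              + (9 * (of_nat n)\<^sup>2 * (cubic_coeff n * k n x)))"
    proof (rule sum.cong)
      fix n
      have "9 * (of_nat (Suc n))\<^sup>2 * (cubic_coeff (Suc n) * k (Suc n) x)
              = (9 * (of_nat n + 1)\<^sup>2 * cubic_coeff (Suc n)) * k (Suc n) x"
        by (simp add: add.commute)
      then show "cubic_coeff n * cubic_op (g n) x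
              = - (9 * (of_nat (Suc n))\<^sup>2 * (cubic_coeff (Suc n) * k (Suc n) x))
                  + (9 * (of_nat n)\<^sup>2 * (cubic_coeff n * k n x))"
        unfolding op[OF x] cubic_coeff_Suc by (simp only:) (simp add: algebra_simps)
    qed simp
    also have "\<dots> = - (9 * (of_nat N)\<^sup>2 * (cubic_coeff N * k N x))"
      by (induction N) simp_all
    finally show ?thesis .
  qed
  moreover have "(\<lambda>N. - (9 * (of_nat N)\<^sup>2 * (cubic_coeff N * k N x))) \<longlonglongrightarrow> 0"
  proof (rule Lim_null_comparison[OF always_eventually])
    have "norm (9 * (of_nat N)\<^sup>2 * (cubic_coeff N * k N x)) \<le> 9 * (real N)\<^sup>2 * (C * (1/2) ^ N)" for N
      unfolding norm_mult[of "9 * (of_nat N)\<^sup>2"]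
      using term_le[OF bk[OF x]]
      by (intro mult_mono) (auto simp: norm_mult norm_power)
    then show "\<forall>N. norm (- (9 * (of_nat N)\<^sup>2 * (cubic_coeff N * k N x)))
                 \<le> 9 * C * ((real N)\<^sup>2 * (1/2) ^ N)"
      by (simp add: mult_ac)
    \<comment> \<open>a square of a null sequence of the form \<open>N r^N\<close>, which handles the factor \<open>N\<^sup>2\<close>\<close>
    have square: "(real N * sqrt (1/2) ^ N)\<^sup>2 = (real N)\<^sup>2 * (1/2) ^ N" for N
    proof -
      have "(sqrt (1/2) ^ N)\<^sup>2 = ((sqrt (1/2))\<^sup>2) ^ N"
        by (simp only: mult.commute flip: power_mult)
      then show ?thesis by (simp only: power_mult_distrib) simp
    qed
    have "(\<lambda>N. (real N * sqrt (1/2) ^ N)\<^sup>2) \<longlonglongrightarrow> 0\<^sup>2"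
      by (intro tendsto_power powser_times_n_limit_0) (simp add: real_sqrt_divide)
    then have "(\<lambda>N. (real N)\<^sup>2 * (1/2) ^ N) \<longlonglongrightarrow> 0"
      by (simp only: square zero_power2)
    then show "(\<lambda>N. 9 * C * ((real N)\<^sup>2 * (1/2) ^ N)) \<longlonglongrightarrow> 0"
      by (rule tendsto_mult_right_zero)
  qed
  ultimately show "cubic_op G x = 0"
    using LIMSEQ_unique by force
qed

text \<open>
  The point 1 is a regular singular point with a double exponent 0, so holomorphic solutions
  there form a line. Concretely, \<open>x (1 - x\<^sup>3)\<close> times the Wronskian of two solutions is constant,
  and it vanishes at 1; so the Wronskian vanishes and the quotient is constant.
\<close>

lemma cubic_op_unique:
  assumes S: "open S" "convex S" "1 \<in> S"
    and dom: "\<And>x. x \<in> S \<Longrightarrow> x \<noteq> 1 \<Longrightarrow> x * (1 - x ^ 3) \<noteq> 0"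
    and f: "f holomorphic_on S" "\<And>x. x \<in> S \<Longrightarrow> cubic_op f x = 0" "\<And>x. x \<in> S \<Longrightarrow> f x \<noteq> 0"
    and g: "g holomorphic_on S" "\<And>x. x \<in> S \<Longrightarrow> cubic_op g x = 0"
    and x: "x \<in> S"
  shows "f 1 * g x = g 1 * f x"
proof -
  define W where "W = (\<lambda>x. x * (1 - x ^ 3) * (deriv g x * f x - g x * deriv f x))"
  note der = holomorphic_derivI[OF f(1) S(1)] holomorphic_derivI[OF g(1) S(1)]
    holomorphic_derivI[OF holomorphic_deriv[OF f(1) S(1)] S(1)]
    holomorphic_derivI[OF holomorphic_deriv[OF g(1) S(1)] S(1)]
  have W': "(W has_field_derivative 0) (at z within S)" if z: "z \<in> S" for z
  proof -
    have "(W has_field_derivative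
             (1 - 4 * z ^ 3) * (deriv g z * f z - g z * deriv f z)
             + z * (1 - z ^ 3) * (deriv (deriv g) z * f z - g z * deriv (deriv f) z)) (at z within S)"
      unfolding W_def
      by (rule derivative_eq_intros der[OF z] refl)+ (simp add: algebra_simps power2_eq_square power3_eq_cube)
    also have "(1 - 4 * z ^ 3) * (deriv g z * f z - g z * deriv f z)
             + z * (1 - z ^ 3) * (deriv (deriv g) z * f z - g z * deriv (deriv f) z)
             = f z * cubic_op g z - g z * cubic_op f z"
      by (simp add: cubic_op_def algebra_simps)
    finally show ?thesis using f g z by simp
  qed
  obtain w where w: "\<And>z. z \<in> S \<Longrightarrow> W z = w"
    using has_field_derivative_zero_constant[OF S(2) W'] by blast
  have "w = 0" using w[OF S(3)] by (simp add: W_def)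
  have wr: "deriv g z * f z - g z * deriv f z = 0" if z: "z \<in> S" for z
  proof (cases "z = 1")
    case True
    \<comment> \<open>at the singular point the leading coefficient vanishes and the equation itself gives the claim\<close>
    have "3 * (deriv g 1 * f 1 - g 1 * deriv f 1) = g 1 * cubic_op f 1 - f 1 * cubic_op g 1"
      by (simp add: cubic_op_def algebra_simps)
    then show ?thesis using True f(2) g(2) S(3) by simp
  next
    case False
    then show ?thesis using w[OF z] \<open>w = 0\<close> dom[OF z] by (auto simp: W_def)
  qed
  have quot: "((\<lambda>z. g z / f z) has_field_derivative 0) (at z within S)" if z: "z \<in> S" for z
    by (rule derivative_eq_intros der[OF z] f(3)[OF z] refl)+ (use wr[OF z] in simp)
  then obtain q where q: "\<And>z. z \<in> S \<Longrightarrow> g z / f z = q"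
    using has_field_derivative_zero_constant[OF S(2) quot] by blast
  have "g z = q * f z" if "z \<in> S" for z
    using q[OF that] f(3)[OF that] by (simp add: field_simps)
  from this[OF x] this[OF S(3)] show ?thesis by simp
qed

section \<open>Homogenized Legendre polynomials\<close>

lemma of_nat_plus_2_neq_0: "(of_nat n + 2 :: complex) \<noteq> 0"
proof -
  have "(of_nat n + 2 :: complex) = of_nat (n + 2)" by simp
  also have "\<dots> \<noteq> 0" by (simp only: of_nat_eq_0_iff)
  finally show ?thesis .
qed

text \<open>
  This is \<open>P\<^sub>n(a / b) b\<^sup>n\<close> with \<open>c = b\<^sup>2\<close>, defined by the homogenized form of Bonnet's recurrence.
  It is a polynomial in \<open>a\<close> and \<open>c\<close> and hence makes sense for \<open>b = 0\<close>.
\<close>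

fun legendre_hom :: "nat \<Rightarrow> complex \<Rightarrow> complex \<Rightarrow> complex" where
  "legendre_hom 0 a c = 1"
| "legendre_hom (Suc 0) a c = a"
| "legendre_hom (Suc (Suc n)) a c =
     ((2 * of_nat n + 3) * a * legendre_hom (Suc n) a c - (of_nat n + 1) * c * legendre_hom n a c)
       / (of_nat n + 2)"

lemma legendre_hom_rec:
  "(of_nat n + 2) * legendre_hom (Suc (Suc n)) a c =
     (2 * of_nat n + 3) * a * legendre_hom (Suc n) a c - (of_nat n + 1) * c * legendre_hom n a c"
  using of_nat_plus_2_neq_0[of n] by simp

text \<open>
  For small arguments the recurrence contracts. The geometric decay makes all series
  below converge uniformly near \<open>x = y = 1\<close>, where both arguments vanish.
\<close>

lemma norm_legendre_hom_le:
  assumes "norm a + norm c \<le> 1/4"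
  shows "norm (legendre_hom n a c) \<le> (1/2) ^ n"
  using assms
proof (induction n a c rule: legendre_hom.induct)
  case (2 a c)
  then show ?case using norm_ge_zero[of a] norm_ge_zero[of c] by (simp; linarith)
next
  case (3 n a c)
  let ?p = "(1/2) ^ n :: real"
  have n2: "norm (of_nat n + 2 :: complex) = real n + 2"
    using norm_of_nat[of "n + 2", where 'a = complex] by (simp add: add.commute)
  have n3: "norm (2 * of_nat n + 3 :: complex) = 2 * real n + 3"
    using norm_of_nat[of "2 * n + 3", where 'a = complex] by (simp add: add.commute)
  have n1: "norm (of_nat n + 1 :: complex) = real n + 1"
    using norm_of_nat[of "n + 1", where 'a = complex] by (simp add: add.commute)
  have "(real n + 2) * norm (legendre_hom (Suc (Suc n)) a c)
          = norm ((of_nat n + 2) * legendre_hom (Suc (Suc n)) a c)"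
    by (simp only: norm_mult n2)
  also have "\<dots> \<le> (2 * real n + 3) * norm a * norm (legendre_hom (Suc n) a c)
                   + (real n + 1) * norm c * norm (legendre_hom n a c)"
    unfolding legendre_hom_rec by (rule norm_triangle_le_diff) (simp only: norm_mult n1 n3 order_refl)
  also have "\<dots> \<le> (2 * (real n + 2)) * norm a * (?p / 2) + (real n + 2) * norm c * ?p"
    using 3 by (intro add_mono mult_mono) auto
  also have "\<dots> = (real n + 2) * ((norm a + norm c) * ?p)"
    by (simp add: algebra_simps)
  also have "\<dots> \<le> (real n + 2) * (1/4 * ?p)"
    using 3 by (intro mult_left_mono mult_right_mono) auto
  finally show ?case by simp
qed simp

definition hom_gf :: "complex \<Rightarrow> complex \<Rightarrow> complex fps" where
  "hom_gf a c = Abs_fps (\<lambda>n. legendre_hom n a c)"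

text \<open>
  The classical generating function \<open>(1 - 2 a X + c X\<^sup>2)\<^sup>-\<^sup>1\<^sup>/\<^sup>2\<close>, in a form without roots.
  Bonnet's recurrence is the coefficient form of a first-order differential equation, by which the
  left-hand side has zero formal derivative.
\<close>

lemma legendre_hom_generating_function:
  "(hom_gf a c)\<^sup>2 * (1 - fps_const (2 * a) * fps_X + fps_const c * fps_X\<^sup>2) = 1"
  (is "?G\<^sup>2 * ?R = 1")
proof -
  have R: "?R * F = F - fps_const (2 * a) * (fps_X * F) + fps_const c * (fps_X * (fps_X * F))" for F
    by (simp add: algebra_simps power2_eq_square)
  have R': "fps_deriv ?R = fps_const (- 2 * a) + fps_const (2 * c) * fps_X"
    by (simp add: power2_eq_square numeral_fps_const fps_eq_iff)
  have ode: "2 * (?R * fps_deriv ?G) + fps_deriv ?R * ?G = 0"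
  proof (rule fps_ext)
    fix n
    have two: "2 * F = fps_const 2 * F" for F :: "complex fps"
      by (simp add: numeral_fps_const)
    show "fps_nth (2 * (?R * fps_deriv ?G) + fps_deriv ?R * ?G) n = fps_nth 0 n"
    proof (cases n)
      case 0
      then show ?thesis unfolding R R' two by (simp add: hom_gf_def distrib_right mult.assoc)
    next
      case (Suc m)
      show ?thesis
        using arg_cong[OF legendre_hom_rec[of m a c], of "(*) 2"] unfolding Suc R R' two
        by (cases m) (simp_all add: hom_gf_def distrib_right mult.assoc algebra_simps
                        del: legendre_hom.simps(3))
    qed
  qed
  have "fps_deriv (?G\<^sup>2 * ?R) = ?G * (2 * (?R * fps_deriv ?G) + fps_deriv ?R * ?G)"
    by (simp add: power2_eq_square algebra_simps)
  then have "fps_deriv (?G\<^sup>2 * ?R) = 0"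
    unfolding ode by simp
  then have "?G\<^sup>2 * ?R = fps_const (fps_nth (?G\<^sup>2 * ?R) 0)"
    by (simp only: fps_deriv_eq_0_iff)
  also have "fps_nth (?G\<^sup>2 * ?R) 0 = 1"
    by (simp add: hom_gf_def power2_eq_square)
  finally show ?thesis by simp
qed

section \<open>Differentiating a formal power series in a parameter\<close>

text \<open>
  In a power series \<open>F x\<close> whose coefficients depend on a parameter \<open>x\<close>, the coefficients are
  differentiated one by one. As each coefficient of a product is a finite sum, the product rule
  needs no convergence, and algebraic relations between such series can be differentiated.
\<close>

definition coeff_deriv :: "(complex \<Rightarrow> complex fps) \<Rightarrow> complex fps \<Rightarrow> complex \<Rightarrow> bool" where
  "coeff_deriv F F' z \<longleftrightarrow>
     (\<forall>n. ((\<lambda>x. fps_nth (F x) n) has_field_derivative fps_nth F' n) (at z))"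

lemma coeff_deriv_const: "coeff_deriv (\<lambda>_. F) 0 z"
  by (simp add: coeff_deriv_def)

lemma coeff_deriv_fps_const: "coeff_deriv fps_const 1 z"
  by (simp add: coeff_deriv_def)

lemma coeff_deriv_add:
  "coeff_deriv F F' z \<Longrightarrow> coeff_deriv G G' z \<Longrightarrow> coeff_deriv (\<lambda>x. F x + G x) (F' + G') z"
  by (auto simp: coeff_deriv_def intro!: derivative_eq_intros)

lemma coeff_deriv_diff:
  "coeff_deriv F F' z \<Longrightarrow> coeff_deriv G G' z \<Longrightarrow> coeff_deriv (\<lambda>x. F x - G x) (F' - G') z"
  by (auto simp: coeff_deriv_def intro!: derivative_eq_intros)

lemma coeff_deriv_mult:
  assumes "coeff_deriv F F' z" "coeff_deriv G G' z"
  shows "coeff_deriv (\<lambda>x. F x * G x) (F' * G z + F z * G') z"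
  unfolding coeff_deriv_def
proof
  fix n
  have F: "((\<lambda>x. fps_nth (F x) i) has_field_derivative fps_nth F' i) (at z)"
   and G: "((\<lambda>x. fps_nth (G x) i) has_field_derivative fps_nth G' i) (at z)" for i
    using assms by (auto simp: coeff_deriv_def)
  show "((\<lambda>x. fps_nth (F x * G x) n) has_field_derivative fps_nth (F' * G z + F z * G') n) (at z)"
    unfolding fps_mult_nth fps_add_nth
    by (rule derivative_eq_intros F G refl)+ (simp add: sum.distrib algebra_simps)
qed

lemma coeff_deriv_unique:
  assumes "coeff_deriv F F' z" "coeff_deriv G G' z" "open S" "z \<in> S" "\<And>x. x \<in> S \<Longrightarrow> F x = G x"
  shows "F' = G'"
proof (rule fps_ext)
  fix n
  have "((\<lambda>x. fps_nth (F x) n) has_field_derivative fps_nth F' n) (at z)"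
   "((\<lambda>x. fps_nth (G x) n) has_field_derivative fps_nth G' n) (at z)"
    using assms by (auto simp: coeff_deriv_def)
  moreover from this(1) have "((\<lambda>x. fps_nth (G x) n) has_field_derivative fps_nth F' n) (at z)"
    by (rule has_field_derivative_transform_within_open[OF _ assms(3,4)]) (simp add: assms(5))
  ultimately show "fps_nth F' n = fps_nth G' n" using DERIV_unique by blast
qed

section \<open>The Legendre kernel and its differential equation\<close>

text \<open>
  The heart of the proof: with \<open>R\<close> as below, \<open>K = R\<^sup>-\<^sup>1\<^sup>/\<^sup>2\<close> satisfies a partial differential equation
  in \<open>x\<close> and \<open>t\<close>. Here \<open>K1, K2, R1, R2\<close> stand for derivatives in \<open>x\<close>, and \<open>Kt, Ktt, Rt, Rtt\<close> for
  derivatives in \<open>t\<close>. All derivatives of \<open>K\<close> are multiples of \<open>K\<close> with denominator \<open>4 R\<^sup>2\<close>, so the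
  equation reduces to the polynomial identity \<open>poly\<close>. Being
  stated over an integral domain, it applies to formal power series in \<open>t\<close>.
\<close>

lemma inverse_sqrt_pde:
  fixes K K1 K2 Kt Ktt R R1 R2 Rt Rtt x y t :: "'a :: idom"
  assumes K: "K\<^sup>2 * R = 1"
    and x1: "2 * R * K1 = - (R1 * K)" and x2: "2 * R * K2 = - (R2 * K + 3 * R1 * K1)"
    and t1: "2 * R * Kt = - (Rt * K)" and t2: "2 * R * Ktt = - (Rtt * K + 3 * Rt * Kt)"
    and R: "R = 1 + 4 * x * y * (x + y) - 2 * (x + y - 2 * x\<^sup>2 * y\<^sup>2) * t + (x - y)\<^sup>2 * t\<^sup>2"
    and R1: "R1 = 8 * x * y + 4 * y\<^sup>2 - 2 * t + 8 * x * y\<^sup>2 * t + 2 * (x - y) * t\<^sup>2"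
    and R2: "R2 = 8 * y + 8 * y\<^sup>2 * t + 2 * t\<^sup>2"
    and Rt: "Rt = 2 * (x - y)\<^sup>2 * t - 2 * (x + y - 2 * x\<^sup>2 * y\<^sup>2)"
    and Rtt: "Rtt = 2 * (x - y)\<^sup>2"
    and four: "(4 :: 'a) \<noteq> 0"
  shows "x * (1 - x ^ 3) * K2 + (1 - 4 * x ^ 3) * K1 - 2 * x\<^sup>2 * K
           = (t ^ 3 - 1) * Ktt + 3 * t\<^sup>2 * Kt + t * K"
proof -
  have a: "4 * R\<^sup>2 * K1 = - 2 * R * R1 * K" "4 * R\<^sup>2 * Kt = - 2 * R * Rt * K"
    using x1 t1 by algebra+
  have b: "4 * R\<^sup>2 * K2 = (3 * R1\<^sup>2 - 2 * R * R2) * K" using x1 x2 by algebra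
  have b': "4 * R\<^sup>2 * Ktt = (3 * Rt\<^sup>2 - 2 * R * Rtt) * K" using t1 t2 by algebra
  have poly: "x * (1 - x ^ 3) * (3 * R1\<^sup>2 - 2 * R * R2) - 2 * (1 - 4 * x ^ 3) * R * R1 - 8 * x\<^sup>2 * R\<^sup>2
     = (t ^ 3 - 1) * (3 * Rt\<^sup>2 - 2 * R * Rtt) - 6 * t\<^sup>2 * R * Rt + 4 * t * R\<^sup>2"
    unfolding R R1 R2 Rt Rtt by algebra
  have "4 * R\<^sup>2 * (x * (1 - x ^ 3) * K2 + (1 - 4 * x ^ 3) * K1 - 2 * x\<^sup>2 * K)
     = x * (1 - x ^ 3) * (4 * R\<^sup>2 * K2) + (1 - 4 * x ^ 3) * (4 * R\<^sup>2 * K1) - 8 * x\<^sup>2 * R\<^sup>2 * K"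
    by algebra
  also have "\<dots> = (x * (1 - x ^ 3) * (3 * R1\<^sup>2 - 2 * R * R2) - 2 * (1 - 4 * x ^ 3) * R * R1 - 8 * x\<^sup>2 * R\<^sup>2) * K"
    unfolding a b by algebra
  also have "\<dots> = (t ^ 3 - 1) * (4 * R\<^sup>2 * Ktt) + 3 * t\<^sup>2 * (4 * R\<^sup>2 * Kt) + 4 * R\<^sup>2 * t * K"
    unfolding poly a b' by algebra
  also have "\<dots> = 4 * R\<^sup>2 * ((t ^ 3 - 1) * Ktt + 3 * t\<^sup>2 * Kt + t * K)"
    by algebra
  finally have eq: "4 * R\<^sup>2 * (x * (1 - x ^ 3) * K2 + (1 - 4 * x ^ 3) * K1 - 2 * x\<^sup>2 * K)
     = 4 * R\<^sup>2 * ((t ^ 3 - 1) * Ktt + 3 * t\<^sup>2 * Kt + t * K)" .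
  have "R \<noteq> 0" using K by auto
  then have "4 * R\<^sup>2 \<noteq> 0" using four by simp
  with eq show ?thesis by (simp only: mult_cancel_left) simp
qed

definition kernel_den :: "complex \<Rightarrow> complex \<Rightarrow> complex" where
  "kernel_den x y = 1 + 4 * x * y * (x + y)"

definition legendre_kernel :: "nat \<Rightarrow> complex \<Rightarrow> complex \<Rightarrow> complex" where
  "legendre_kernel n x y =
     legendre_hom n ((x + y - 2 * x\<^sup>2 * y\<^sup>2) / kernel_den x y) ((x - y)\<^sup>2 / kernel_den x y)
       / csqrt (kernel_den x y)"

text \<open>
  Exchanging \<open>x\<close> and \<open>y\<close> changes only the sign of \<open>x - y\<close>, which enters through its square.
\<close>

lemma legendre_kernel_commute: "legendre_kernel n x y = legendre_kernel n y x"
proof -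
  have "kernel_den x y = kernel_den y x" "x + y - 2 * x\<^sup>2 * y\<^sup>2 = y + x - 2 * y\<^sup>2 * x\<^sup>2"
    by (simp_all add: kernel_den_def mult.commute add.commute)
  then show ?thesis unfolding legendre_kernel_def by (simp only: power2_commute[of x y])
qed

lemma holomorphic_legendre_hom:
  assumes "f holomorphic_on S" "g holomorphic_on S"
  shows "(\<lambda>x. legendre_hom n (f x) (g x)) holomorphic_on S"
  by (induction n rule: induct_nat_012) (auto intro!: holomorphic_intros assms simp: of_nat_plus_2_neq_0)

lemma holomorphic_legendre_kernel:
  assumes "\<And>x. x \<in> S \<Longrightarrow> Re (kernel_den x y) > 0"
  shows "(\<lambda>x. legendre_kernel n x y) holomorphic_on S"
proof -
  have nz: "kernel_den x y \<noteq> 0" if "x \<in> S" for x using assms[OF that] by auto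
  have hol: "(\<lambda>x. kernel_den x y) holomorphic_on S"
    unfolding kernel_den_def by (intro holomorphic_intros)
  show ?thesis unfolding legendre_kernel_def
    by (intro holomorphic_intros holomorphic_legendre_hom hol)
       (use nz assms in \<open>auto simp: complex_nonpos_Reals_iff dest: assms\<close>)
qed

definition kernel_gf :: "complex \<Rightarrow> complex \<Rightarrow> complex fps" where
  "kernel_gf x y = Abs_fps (\<lambda>n. legendre_kernel n x y)"

text \<open>
  The expression under the root in the generating function. It is stated over a general ring since
  \<open>x\<close>, \<open>y\<close> and \<open>t\<close> are replaced by power series.
\<close>

definition kernel_disc :: "'a :: comm_ring_1 \<Rightarrow> 'a \<Rightarrow> 'a \<Rightarrow> 'a" where
  "kernel_disc x y t = 1 + 4 * x * y * (x + y) - 2 * (x + y - 2 * x\<^sup>2 * y\<^sup>2) * t + (x - y)\<^sup>2 * t\<^sup>2"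

lemma kernel_gf_sq:
  assumes "kernel_den x y \<noteq> 0"
  shows "(kernel_gf x y)\<^sup>2 * kernel_disc (fps_const x) (fps_const y) fps_X = 1"
proof -
  let ?D = "kernel_den x y"
  let ?a = "(x + y - 2 * x\<^sup>2 * y\<^sup>2) / ?D" and ?c = "(x - y)\<^sup>2 / ?D"
  let ?R = "1 - fps_const (2 * ?a) * fps_X + fps_const ?c * fps_X\<^sup>2"
  have gf: "kernel_gf x y = fps_const (1 / csqrt ?D) * hom_gf ?a ?c"
    by (simp add: fps_eq_iff kernel_gf_def legendre_kernel_def hom_gf_def)
  have disc: "kernel_disc (fps_const x) (fps_const y) fps_X
          = fps_const ?D - fps_const (2 * (x + y - 2 * x\<^sup>2 * y\<^sup>2)) * fps_X
            + fps_const ((x - y)\<^sup>2) * fps_X\<^sup>2"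
    by (simp add: kernel_disc_def kernel_den_def numeral_fps_const fps_const_power)
  also have "fps_const (2 * (x + y - 2 * x\<^sup>2 * y\<^sup>2)) = fps_const ?D * fps_const (2 * ?a)"
    using assms by simp
  also have "fps_const ((x - y)\<^sup>2) = fps_const ?D * fps_const ?c"
    using assms by simp
  also have "fps_const ?D - fps_const ?D * fps_const (2 * ?a) * fps_X
               + fps_const ?D * fps_const ?c * fps_X\<^sup>2 = fps_const ?D * ?R"
    by (simp only: ring_distribs mult_1_right mult.assoc)
  finally have "(kernel_gf x y)\<^sup>2 * kernel_disc (fps_const x) (fps_const y) fps_X
     = fps_const ((1 / csqrt ?D)\<^sup>2 * ?D) * ((hom_gf ?a ?c)\<^sup>2 * ?R)"
    unfolding gf by (simp only: power_mult_distrib fps_const_power mult_ac flip: fps_const_mult)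
  also have "\<dots> = 1"
    unfolding legendre_hom_generating_function using assms by (simp add: power_divide)
  finally show ?thesis .
qed

text \<open>
  The coefficient of \<open>t\<^sup>n\<close> in the partial differential equation of the generating function.
  For \<open>n = 0\<close> the truncated index \<open>n - 1\<close> comes with the factor 0.
\<close>

lemma cubic_op_legendre_kernel:
  assumes S: "open S" "x \<in> S" and den: "\<And>x. x \<in> S \<Longrightarrow> Re (kernel_den x y) > 0"
  shows "cubic_op (\<lambda>x. legendre_kernel n x y) x
           = (of_nat n)\<^sup>2 * legendre_kernel (n - 1) x y
             - (of_nat n + 1) * (of_nat n + 2) * legendre_kernel (n + 2) x y"
proof -
  define K where "K = (\<lambda>x. kernel_gf x y)"
  define K1 where "K1 = (\<lambda>x. Abs_fps (\<lambda>n. deriv (\<lambda>x. legendre_kernel n x y) x))"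
  define K2 where "K2 = (\<lambda>x. Abs_fps (\<lambda>n. deriv (deriv (\<lambda>x. legendre_kernel n x y)) x))"
  define Y where "Y = fps_const y"
  define R where "R = (\<lambda>x. kernel_disc (fps_const x) Y fps_X)"
  define R1 where "R1 = (\<lambda>x. 8 * fps_const x * Y + 4 * Y\<^sup>2 - 2 * fps_X + 8 * fps_const x * Y\<^sup>2 * fps_X
                              + 2 * (fps_const x - Y) * fps_X\<^sup>2)"
  define R2 where "R2 = 8 * Y + 8 * Y\<^sup>2 * fps_X + 2 * fps_X\<^sup>2"
  note hol = holomorphic_legendre_kernel[of S y, OF den]
  have K: "coeff_deriv K (K1 z) z" "coeff_deriv K1 (K2 z) z" if "z \<in> S" for z
    unfolding coeff_deriv_def K_def K1_def K2_def kernel_gf_def fps_nth_Abs_fps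
    using holomorphic_derivI[OF hol S(1) that]
      holomorphic_derivI[OF holomorphic_deriv[OF hol S(1)] S(1) that] by auto
  note cd = coeff_deriv_add coeff_deriv_diff coeff_deriv_mult coeff_deriv_const coeff_deriv_fps_const
  have R: "coeff_deriv R (R1 z) z" for z
    unfolding R_def R1_def kernel_disc_def power2_eq_square
    by (rule back_subst[where P = "\<lambda>F. coeff_deriv _ F z"], (rule cd)+) algebra
  have R1: "coeff_deriv R1 R2 z" for z
    unfolding R1_def
    by (rule back_subst[where P = "\<lambda>F. coeff_deriv _ F z"], (rule cd)+)
       (simp add: R2_def)
  have KR: "K z * K z * R z = 1" if "z \<in> S" for z
    using kernel_gf_sq[of z y] den[OF that] by (force simp: K_def R_def Y_def power2_eq_square)
  have K_nz: "K z \<noteq> 0" if "z \<in> S" for z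
    using KR[OF that] by auto
  have x1: "2 * R z * K1 z = - (R1 z * K z)" if z: "z \<in> S" for z
  proof -
    have "(K1 z * K z + K z * K1 z) * R z + K z * K z * R1 z = 0"
      by (rule coeff_deriv_unique[OF _ _ S(1) z KR]) (rule cd K R z)+
    then have "K z * (2 * R z * K1 z + R1 z * K z) = 0" by algebra
    then show ?thesis using K_nz[OF z] by (simp add: eq_neg_iff_add_eq_0)
  qed
  have x2: "2 * R x * K2 x = - (R2 * K x + 3 * R1 x * K1 x)"
  proof -
    have "coeff_deriv (\<lambda>z. 2 * R z * K1 z + R1 z * K z)
            ((0 * R x + 2 * R1 x) * K1 x + 2 * R x * K2 x + (R2 * K x + R1 x * K1 x)) x"
      by (rule cd K R R1 S)+
    then have "(0 * R x + 2 * R1 x) * K1 x + 2 * R x * K2 x + (R2 * K x + R1 x * K1 x) = 0"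
      by (rule coeff_deriv_unique[OF _ coeff_deriv_const S]) (simp add: x1)
    then show ?thesis by algebra
  qed
  define Kt where "Kt = fps_deriv (K x)"
  define Ktt where "Ktt = fps_deriv Kt"
  define Rt where "Rt = 2 * (fps_const x - Y)\<^sup>2 * fps_X - 2 * (fps_const x + Y - 2 * (fps_const x)\<^sup>2 * Y\<^sup>2)"
  define Rtt where "Rtt = 2 * (fps_const x - Y)\<^sup>2"
  have Rt: "fps_deriv (R x) = Rt" and Rtt: "fps_deriv Rt = Rtt"
    by (simp_all add: R_def Rt_def Rtt_def kernel_disc_def Y_def power2_eq_square algebra_simps)
  have t1: "2 * R x * Kt = - (Rt * K x)"
  proof -
    have "fps_deriv (K x * K x * R x) = 0" by (simp add: KR[OF S(2)])
    then have "K x * (2 * R x * Kt + Rt * K x) = 0"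
      unfolding fps_deriv_mult Rt Kt_def[symmetric] by algebra
    then show ?thesis using K_nz[OF S(2)] by (simp add: eq_neg_iff_add_eq_0)
  qed
  have t2: "2 * R x * Ktt = - (Rtt * K x + 3 * Rt * Kt)"
  proof -
    have "fps_deriv (2 * R x * Kt + Rt * K x) = 0" by (simp add: t1)
    then have "2 * (Rt * Kt + R x * Ktt) + (Rtt * K x + Rt * Kt) = 0"
      by (simp add: Rt Rtt Ktt_def Kt_def[symmetric] algebra_simps)
    then show ?thesis by algebra
  qed
  have "fps_const x * (1 - fps_const x ^ 3) * K2 x + (1 - 4 * fps_const x ^ 3) * K1 x
           - 2 * (fps_const x)\<^sup>2 * K x
        = (fps_X ^ 3 - 1) * Ktt + 3 * fps_X\<^sup>2 * Kt + fps_X * K x"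
    by (rule inverse_sqrt_pde[OF _ x1[OF S(2)] x2 t1 t2 _ R1_def[THEN fun_cong] R2_def Rt_def Rtt_def])
       (use KR[OF S(2)] in \<open>simp_all add: R_def kernel_disc_def power2_eq_square\<close>)
  \<comment> \<open>this form shows the factor \<open>n\<^sup>2\<close>: two Euler derivations after one shift\<close>
  also have "\<dots> = fps_X * fps_deriv (fps_X * fps_deriv (fps_X * K x)) - Ktt"
    by (simp add: Ktt_def Kt_def algebra_simps power2_eq_square power3_eq_cube)
  finally have ode: "fps_const x * (1 - fps_const x ^ 3) * K2 x + (1 - 4 * fps_const x ^ 3) * K1 x
           - 2 * (fps_const x)\<^sup>2 * K x
         = fps_X * fps_deriv (fps_X * fps_deriv (fps_X * K x)) - Ktt" .
  have coeffs: "fps_const x * (1 - fps_const x ^ 3) = fps_const (x * (1 - x ^ 3))"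
    "1 - 4 * fps_const x ^ 3 = fps_const (1 - 4 * x ^ 3)"
    "2 * (fps_const x)\<^sup>2 = fps_const (2 * x\<^sup>2)"
    by (simp_all add: numeral_fps_const flip: fps_const_sub fps_const_mult fps_const_power)
  have nths: "fps_nth (K x) m = legendre_kernel m x y"
    "fps_nth (K1 x) m = deriv (\<lambda>x. legendre_kernel m x y) x"
    "fps_nth (K2 x) m = deriv (deriv (\<lambda>x. legendre_kernel m x y)) x" for m
    by (simp_all add: K_def K1_def K2_def kernel_gf_def)
  have "cubic_op (\<lambda>x. legendre_kernel n x y) x
          = fps_nth (fps_X * fps_deriv (fps_X * fps_deriv (fps_X * K x)) - Ktt) n"
    unfolding ode[symmetric] coeffs cubic_op_def by (simp add: nths)
  also have "\<dots> = (of_nat n)\<^sup>2 * legendre_kernel (n - 1) x y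
             - (of_nat n + 1) * (of_nat n + 2) * legendre_kernel (n + 2) x y"
    unfolding Ktt_def Kt_def
    by (cases n) (simp_all add: nths power2_eq_square algebra_simps del: fps_deriv_mult)
  finally show ?thesis .
qed

section \<open>Legendre polynomials and the summands on and off the diagonal\<close>

lemma minus_of_nat_nonpos_Int: "- of_nat n \<in> (\<int>\<^sub>\<le>\<^sub>0 :: complex set)"
  by (simp add: nonpos_Ints_def) (metis of_int_minus of_int_of_nat_eq neg_le_0_iff_le of_nat_0_le_iff)

definition legendre_coeff :: "complex \<Rightarrow> nat \<Rightarrow> complex" where
  "legendre_coeff m k = pochhammer (- m) k * pochhammer (m + 1) k / (fact k)\<^sup>2"

lemma legendre_poly_eq_sum:
  assumes "n < N"
  shows "legendre_poly n z = (\<Sum>k<N. legendre_coeff (of_nat n) k * ((1 - z) / 2) ^ k)"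
proof -
  have "legendre_poly n z = (\<Sum>k. legendre_coeff (of_nat n) k * ((1 - z) / 2) ^ k)"
    by (simp add: legendre_poly_def hyp2F1_def hyp2F1_series_def minus_of_nat_nonpos_Int
          legendre_coeff_def power2_eq_square flip: pochhammer_fact)
  also have "\<dots> = (\<Sum>k<N. legendre_coeff (of_nat n) k * ((1 - z) / 2) ^ k)"
  proof (rule suminf_finite)
    fix k assume "k \<notin> {..<N}"
    then have "pochhammer (- of_nat n :: complex) k = 0"
      using assms by (intro pochhammer_of_nat_eq_0_lemma) simp
    then show "legendre_coeff (of_nat n) k * ((1 - z) / 2) ^ k = 0"
      by (simp add: legendre_coeff_def)
  qed simp
  finally show ?thesis .
qed

text \<open>
  Bonnet's recurrence for the coefficients of powers of \<open>(1 - z) / 2\<close>. All Pochhammer symbols that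
  occur are multiples of \<open>P\<close> and \<open>Q\<close>, after multiplication by \<open>m\<close> or \<open>m + 1\<close> where an
  argument is raised by one; what is left is a polynomial identity.
\<close>

lemma legendre_coeff_rec:
  assumes "m \<noteq> 0" "m + 1 \<noteq> 0"
  shows "(m + 1) * legendre_coeff (m + 1) (Suc j)
           = (2 * m + 1) * (legendre_coeff m (Suc j) - 2 * legendre_coeff m j)
             - m * legendre_coeff (m - 1) (Suc j)"
proof -
  define J :: complex where "J = of_nat j"
  define P where "P = pochhammer (- m) j"
  define Q where "Q = pochhammer (m + 1) j"
  have up1: "pochhammer (- (m + 1)) (Suc j) = - (m + 1) * P"
    by (simp add: pochhammer_rec P_def)
  have up2: "(m + 1) * pochhammer (m + 1 + 1) (Suc j) = Q * (m + 1 + J) * (m + 2 + J)"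
    using pochhammer_rec[of "m + 1" "Suc j"]
    by (simp add: pochhammer_Suc Q_def J_def algebra_simps)
  have mid: "pochhammer (- m) (Suc j) = P * (J - m)" "pochhammer (m + 1) (Suc j) = Q * (m + 1 + J)"
    by (simp_all add: pochhammer_Suc P_def Q_def J_def)
  have dn1: "- m * pochhammer (- (m - 1)) (Suc j) = P * (J - m) * (J + 1 - m)"
    using pochhammer_rec[of "- m" "Suc j"]
    by (simp add: pochhammer_Suc P_def J_def algebra_simps)
  have dn2: "pochhammer (m - 1 + 1) (Suc j) = m * Q"
    by (simp add: pochhammer_rec Q_def)
  have J1: "J + 1 \<noteq> 0" unfolding J_def by (metis of_nat_Suc of_nat_neq_0 add.commute)
  have fact: "(fact (Suc j) :: complex)\<^sup>2 = (J + 1)\<^sup>2 * (fact j)\<^sup>2"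
    by (simp add: J_def power_mult_distrib add.commute)
  have up: "(m + 1) * (pochhammer (- (m + 1)) (Suc j) * pochhammer (m + 1 + 1) (Suc j))
     = - (m + 1) * P * (Q * (m + 1 + J) * (m + 2 + J))"
    unfolding up1 up2[symmetric] by algebra
  have dn: "m * (pochhammer (- (m - 1)) (Suc j) * pochhammer (m - 1 + 1) (Suc j))
     = - m * Q * (P * (J - m) * (J + 1 - m))"
    unfolding dn2 dn1[symmetric] by algebra
  have eq: "(m + 1) * (pochhammer (- (m + 1)) (Suc j) * pochhammer (m + 1 + 1) (Suc j))
     = (2 * m + 1) * (pochhammer (- m) (Suc j) * pochhammer (m + 1) (Suc j) - 2 * (P * Q * (J + 1)\<^sup>2))
       - m * (pochhammer (- (m - 1)) (Suc j) * pochhammer (m - 1 + 1) (Suc j))"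
    unfolding up dn mid by algebra
  have coeff_j: "legendre_coeff m j = P * Q * (J + 1)\<^sup>2 / (fact (Suc j))\<^sup>2"
    unfolding fact using J1 by (simp add: legendre_coeff_def P_def Q_def)
  show ?thesis
    unfolding coeff_j unfolding legendre_coeff_def
    by (simp only: times_divide_eq_right eq flip: diff_divide_distrib)
qed

lemma legendre_poly_0: "legendre_poly 0 z = 1"
  using legendre_poly_eq_sum[of 0 1 z] by (simp add: legendre_coeff_def)

lemma legendre_poly_1: "legendre_poly (Suc 0) z = z"
  using legendre_poly_eq_sum[of "Suc 0" 2 z]
  by (simp add: legendre_coeff_def numeral_2_eq_2 field_simps)

lemma legendre_poly_rec:
  "(of_nat n + 2) * legendre_poly (Suc (Suc n)) z
     = (2 * of_nat n + 3) * z * legendre_poly (Suc n) z - (of_nat n + 1) * legendre_poly n z"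
proof -
  define w where "w = (1 - z) / 2"
  define m :: complex where "m = of_nat n + 1"
  define N where "N = n + 2"
  have m: "m \<noteq> 0" "m + 1 \<noteq> 0"
    using of_nat_neq_0[of n, where 'a = complex] of_nat_neq_0[of "Suc n", where 'a = complex]
    by (simp_all add: m_def algebra_simps)
  define S where "S = (\<lambda>q. \<Sum>k<N. legendre_coeff q (Suc k) * w ^ Suc k)"
  have c0: "legendre_coeff q 0 = 1" for q by (simp add: legendre_coeff_def)
  have P: "legendre_poly i z = 1 + S (of_nat i)" if "i < Suc N" for i
    unfolding legendre_poly_eq_sum[OF that] sum.lessThan_Suc_shift w_def[symmetric] S_def
    by (simp add: c0)
  have P': "legendre_poly (Suc n) z = (\<Sum>k<N. legendre_coeff m k * w ^ k)"
    using legendre_poly_eq_sum[of "Suc n" N z] by (simp add: N_def w_def m_def add.commute)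
  have "(m + 1) * S (m + 1) = (\<Sum>k<N. ((m + 1) * legendre_coeff (m + 1) (Suc k)) * w ^ Suc k)"
    by (simp add: S_def sum_distrib_left mult.assoc)
  also have "\<dots> = (2 * m + 1) * (S m - 2 * w * (\<Sum>k<N. legendre_coeff m k * w ^ k)) - m * S (m - 1)"
    unfolding legendre_coeff_rec[OF m] S_def
    by (simp add: sum_distrib_left sum_subtractf sum.distrib algebra_simps)
  finally have "(m + 1) * (1 + S (m + 1))
     = (2 * m + 1) * ((1 + S m) - 2 * w * legendre_poly (Suc n) z) - m * (1 + S (m - 1))"
    unfolding P' by algebra
  moreover have "1 + S (m + 1) = legendre_poly (Suc (Suc n)) z" "1 + S m = legendre_poly (Suc n) z"
      "1 + S (m - 1) = legendre_poly n z"
    using P[of "Suc (Suc n)"] P[of "Suc n"] P[of n] by (simp_all add: N_def m_def add_ac)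
  ultimately have "(m + 1) * legendre_poly (Suc (Suc n)) z
     = (2 * m + 1) * (legendre_poly (Suc n) z - 2 * w * legendre_poly (Suc n) z) - m * legendre_poly n z"
    by (simp only:)
  moreover have "2 * w = 1 - z" by (simp add: w_def)
  ultimately show ?thesis unfolding m_def by algebra
qed

lemma legendre_poly_homogenize:
  assumes "b \<noteq> 0"
  shows "legendre_poly n (a / b) * b ^ n = legendre_hom n a (b\<^sup>2)"
proof (induction n rule: induct_nat_012)
  case (ge2 n)
  have "(of_nat n + 2) * (legendre_poly (Suc (Suc n)) (a / b) * b ^ Suc (Suc n))
     = (of_nat n + 2) * legendre_poly (Suc (Suc n)) (a / b) * b ^ Suc (Suc n)"
    by (simp only: mult.assoc)
  also have "\<dots> = (2 * of_nat n + 3) * a * (legendre_poly (Suc n) (a / b) * b ^ Suc n)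
              - (of_nat n + 1) * b\<^sup>2 * (legendre_poly n (a / b) * b ^ n)"
    unfolding legendre_poly_rec using assms by (simp add: field_simps power2_eq_square)
  also have "\<dots> = (of_nat n + 2) * legendre_hom (Suc (Suc n)) a (b\<^sup>2)"
    unfolding ge2 legendre_hom_rec ..
  finally show ?case using of_nat_plus_2_neq_0 by (simp only: mult_cancel_left) simp
qed (use assms in \<open>simp_all add: legendre_poly_0 legendre_poly_1\<close>)

lemma kernel_den_of_real:
  "kernel_den (of_real x) (of_real y) = of_real (1 + 4 * x * y * (x + y))"
  by (simp add: kernel_den_def)

lemma legendre_factor_offdiag_eq:
  assumes "x \<noteq> y" "1 + 4 * x * y * (x + y) > 0"
  shows "legendre_factor_offdiag n x y = of_real (sqrt (1 + 4 * x * y * (x + y))) * legendre_kernel n (of_real x) (of_real y)"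
proof -
  define D where "D = 1 + 4 * x * y * (x + y)"
  define b where "b = (x - y) / sqrt D"
  define a where "a = (x + y - 2 * x\<^sup>2 * y\<^sup>2) / D"
  have D: "D > 0" using assms by (simp add: D_def)
  have b: "b \<noteq> 0" using D assms by (simp add: b_def)
  have ab: "(x + y - 2 * x\<^sup>2 * y\<^sup>2) / ((x - y) * sqrt D) = a / b"
    using D assms(1) real_sqrt_mult_self[of D] by (simp add: a_def b_def divide_simps)
  have b2: "b\<^sup>2 = (x - y)\<^sup>2 / D"
    using D by (simp add: b_def power_divide)
  have "legendre_factor_offdiag n x y = legendre_poly n (of_real a / of_real b) * of_real b ^ n"
    unfolding legendre_factor_offdiag_def D_def[symmetric] ab by (simp add: b_def)
  also have "\<dots> = legendre_hom n (of_real a) (of_real (b\<^sup>2))"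
    using b by (simp add: legendre_poly_homogenize)
  also have "\<dots> = of_real (sqrt D) * legendre_kernel n (of_real x) (of_real y)"
    unfolding legendre_kernel_def kernel_den_of_real D_def[symmetric] b2
    using D by (simp add: a_def csqrt_of_real_nonneg)
  finally show ?thesis by (simp add: D_def)
qed

lemma isCont_legendre_hom:
  fixes f g :: "'a :: t2_space \<Rightarrow> complex"
  assumes "isCont f p" "isCont g p"
  shows "isCont (\<lambda>p. legendre_hom n (f p) (g p)) p"
  by (induction n rule: induct_nat_012) (auto intro!: continuous_intros assms simp: of_nat_plus_2_neq_0)

lemma isCont_legendre_kernel:
  assumes "Re (kernel_den (fst p) (snd p)) > 0"
  shows "isCont (\<lambda>p. legendre_kernel n (fst p) (snd p)) p"
proof -
  have nz: "kernel_den (fst p) (snd p) \<noteq> 0" using assms by auto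
  have c: "isCont (\<lambda>p. kernel_den (fst p) (snd p)) p"
    unfolding kernel_den_def by (intro continuous_intros)
  show ?thesis unfolding legendre_kernel_def
    by (intro continuous_intros isCont_legendre_hom c isCont_o2[OF c] continuous_at_csqrt)
       (use nz assms in \<open>auto simp: complex_nonpos_Reals_iff\<close>)
qed

text \<open>
  Off the diagonal this is the homogenization above. The right-hand side is continuous
  also on the diagonal, so it is the continuous extension there.
\<close>

lemma legendre_factor_eq:
  assumes "1 + 4 * x * y * (x + y) > 0"
  shows "legendre_factor n x y = of_real (sqrt (1 + 4 * x * y * (x + y))) * legendre_kernel n (of_real x) (of_real y)"
proof (cases "x = y")
  case False
  then show ?thesis using assms by (simp add: legendre_factor_def legendre_factor_offdiag_eq)
next
  case True
  define D where "D = (\<lambda>p :: real \<times> real. 1 + 4 * fst p * snd p * (fst p + snd p))"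
  define F where "F = (\<lambda>p. complex_of_real (sqrt (D p)) * legendre_kernel n (of_real (fst p)) (of_real (snd p)))"
  have D: "D (x, y) > 0" using assms by (simp add: D_def)
  have contD: "isCont D (x, y)" unfolding D_def by (intro continuous_intros)
  have contq: "isCont (\<lambda>p. (complex_of_real (fst p), complex_of_real (snd p))) (x, y)"
    by (intro continuous_intros)
  have "isCont (\<lambda>p. legendre_kernel n (of_real (fst p)) (of_real (snd p))) (x, y)"
    using isCont_o2[OF contq, of "\<lambda>p. legendre_kernel n (fst p) (snd p)"] isCont_legendre_kernel D
    by (simp add: D_def kernel_den_of_real)
  then have contF: "isCont F (x, y)"
    unfolding F_def using contD by (intro continuous_intros)
  let ?at = "at (x, y) within {(u, v). u \<noteq> v}"
  have "eventually (\<lambda>p. D p > 0) ?at"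
    using order_tendstoD(1)[OF contD[unfolded isCont_def] D]
    by (rule filter_leD[OF at_le, rotated]) simp
  moreover have off_diag: "eventually (\<lambda>p. fst p \<noteq> snd p) ?at"
    by (auto simp: eventually_at_filter intro!: always_eventually)
  ultimately have "eventually (\<lambda>p. F p = (case p of (u, v) \<Rightarrow> legendre_factor_offdiag n u v)) ?at"
    by eventually_elim (auto simp: F_def D_def legendre_factor_offdiag_eq split: prod.splits)
  moreover have "(F \<longlongrightarrow> F (x, y)) ?at"
    using contF by (auto simp: isCont_def intro: tendsto_within_subset)
  ultimately have "((\<lambda>(u, v). legendre_factor_offdiag n u v) \<longlongrightarrow> F (x, y)) ?at"
    by (rule Lim_transform_eventually[rotated])
  \<comment> \<open>the diagonal points are limits of off-diagonal ones, so the limit is unique\<close>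
  moreover have "?at \<noteq> bot"
  proof -
    have "(x, y) islimpt {(u, v). u \<noteq> v}"
      unfolding islimpt_approachable
    proof (intro allI impI)
      fix e :: real assume "e > 0"
      then show "\<exists>p\<in>{(u, v). u \<noteq> v}. p \<noteq> (x, y) \<and> dist p (x, y) < e"
        using True by (intro bexI[of _ "(x + e / 2, y)"]) (auto simp: dist_Pair_Pair dist_real_def)
    qed
    then show ?thesis by (simp add: trivial_limit_within)
  qed
  ultimately have "Lim ?at (\<lambda>(u, v). legendre_factor_offdiag n u v) = F (x, y)"
    by (intro tendsto_Lim)
  then show ?thesis using True by (simp add: legendre_factor_def F_def D_def)
qed

section \<open>Factorization of the kernel series near the point (1, 1)\<close>

definition cubic_fun :: "complex \<Rightarrow> complex" where
  "cubic_fun x = (\<Sum>n. cubic_coeff n * (1 - x ^ 3) ^ n)"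

lemma hyp2F1_eq_cubic_fun:
  assumes "norm (1 - x ^ 3) < 1"
  shows "hyp2F1 (1/3) (2/3) 1 (1 - x ^ 3) = cubic_fun x"
  using assms
  by (simp add: hyp2F1_def hyp2F1_series_def cubic_fun_def cubic_coeff_def power2_eq_square
        flip: pochhammer_fact)

lemma cubic_fun_1: "cubic_fun 1 = 1"
proof -
  have "cubic_fun 1 = (\<Sum>n\<in>{0}. cubic_coeff n * (1 - 1 ^ 3) ^ n)"
    unfolding cubic_fun_def by (rule suminf_finite) auto
  then show ?thesis by simp
qed

text \<open>
  The telescoping form of the hypergeometric equation, with
  \<open>k n x = x\<^sup>2 (1 - x\<^sup>3)\<^sup>n\<^sup>-\<^sup>1\<close> as the second sequence.
\<close>

lemma cubic_op_power:
  "cubic_op (\<lambda>x. (1 - x ^ 3) ^ n) x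
     = 9 * (of_nat n)\<^sup>2 * (x\<^sup>2 * (1 - x ^ 3) ^ (n - 1))
       - (3 * of_nat n + 1) * (3 * of_nat n + 2) * (x\<^sup>2 * (1 - x ^ 3) ^ n)"
proof -
  have d: "deriv (\<lambda>x :: complex. (1 - x ^ 3) ^ n) = (\<lambda>x. - 3 * of_nat n * x\<^sup>2 * (1 - x ^ 3) ^ (n - 1))"
    by (rule ext, rule DERIV_imp_deriv) (rule derivative_eq_intros refl | simp)+
  have dd: "deriv (\<lambda>x. - 3 * of_nat n * x\<^sup>2 * (1 - x ^ 3) ^ (n - 1)) x
       = - 6 * of_nat n * x * (1 - x ^ 3) ^ (n - 1)
         + 9 * of_nat n * of_nat (n - 1) * x ^ 4 * (1 - x ^ 3) ^ (n - 2)"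
    by (rule DERIV_imp_deriv)
       (rule derivative_eq_intros refl | simp add: eval_nat_numeral algebra_simps)+
  define u where "u = 1 - x ^ 3"
  have x3: "x ^ 3 = 1 - u" by (simp add: u_def)
  consider "n = 0" | "n = 1" | m where "n = Suc (Suc m)"
    by (metis One_nat_def not0_implies_Suc)
  then show ?thesis
  proof cases
    case 1
    then show ?thesis by (simp add: cubic_op_def d)
  next
    case 2
    have "cubic_op (\<lambda>x. (1 - x ^ 3) ^ n) x
       = x * (1 - x ^ 3) * (- 6 * x) + (1 - 4 * x ^ 3) * (- 3 * x\<^sup>2) - 2 * x\<^sup>2 * (1 - x ^ 3)"
      unfolding cubic_op_def d dd unfolding 2 by simp
    also have "\<dots> = 9 * x\<^sup>2 - 4 * 5 * (x\<^sup>2 * (1 - x ^ 3))" by algebra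
    finally show ?thesis by (simp add: 2)
  next
    case 3
    show ?thesis
      unfolding cubic_op_def d dd unfolding u_def[symmetric] x3 unfolding 3
      using x3 by (simp add: u_def) (algebra)
  qed
qed

lemma open_cubic_domain: "open {x :: complex. norm (1 - x ^ 3) < 1/2}"
  by (intro open_Collect_less continuous_intros)

lemma norm_power_le_half:
  assumes "norm (x :: complex) \<le> 1/2"
  shows "norm (x ^ n) \<le> (1/2) ^ n"
  unfolding norm_power by (rule power_mono) (use assms in auto)

lemma
  defines "S \<equiv> {x :: complex. norm (1 - x ^ 3) < 1/2}"
  shows holomorphic_cubic_fun: "cubic_fun holomorphic_on S"
    and cubic_op_cubic_fun: "\<And>x. x \<in> S \<Longrightarrow> cubic_op cubic_fun x = 0"
proof -
  let ?g = "\<lambda>n x :: complex. (1 - x ^ 3) ^ n"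
  let ?k = "\<lambda>n x :: complex. x\<^sup>2 * (1 - x ^ 3) ^ (n - 1)"
  have S: "open S" unfolding S_def by (rule open_cubic_domain)
  have hol: "?g n holomorphic_on S" for n by (intro holomorphic_intros)
  have op: "cubic_op (?g n) x = 9 * (of_nat n)\<^sup>2 * ?k n x - (3 * of_nat n + 1) * (3 * of_nat n + 2) * ?k (Suc n) x"
    for n x by (simp add: cubic_op_power)
  have g: "norm (?g n x) \<le> 8 * (1/2) ^ n" if "x \<in> S" for n x
  proof -
    have "norm (?g n x) \<le> (1/2) ^ n"
      by (rule norm_power_le_half) (use that in \<open>simp add: S_def\<close>)
    also have "\<dots> \<le> 8 * (1/2) ^ n" by simp
    finally show ?thesis .
  qed
  have k: "norm (?k n x) \<le> 8 * (1/2) ^ n" if x: "x \<in> S" for n x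
  proof -
    have "norm x ^ 3 \<le> 2 ^ 3"
      using x norm_triangle_ineq3[of 1 "x ^ 3"] by (simp add: S_def norm_power)
    then have "norm x \<le> 2"
      by (simp only: power_mono_iff norm_ge_zero zero_le_numeral zero_less_numeral)
    then have "norm (x\<^sup>2) \<le> 2\<^sup>2"
      unfolding norm_power by (intro power_mono) auto
    moreover have "norm ((1 - x ^ 3) ^ (n - 1)) \<le> (1/2) ^ (n - 1)"
      by (rule norm_power_le_half) (use x in \<open>simp add: S_def\<close>)
    ultimately have "norm (?k n x) \<le> 2\<^sup>2 * (1/2) ^ (n - 1)"
      unfolding norm_mult by (intro mult_mono) auto
    also have "\<dots> \<le> 8 * (1/2) ^ n" by (cases n) auto
    finally show ?thesis .
  qed
  have "cubic_fun = (\<lambda>x. \<Sum>n. cubic_coeff n * ?g n x)"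
    by (simp add: cubic_fun_def fun_eq_iff)
  with cubic_op_series_eq_0[OF S hol op g k]
  show "cubic_fun holomorphic_on S" "\<And>x. x \<in> S \<Longrightarrow> cubic_op cubic_fun x = 0"
    by simp_all
qed

text \<open>
  The region in which the kernel is holomorphic and decays geometrically in \<open>n\<close>: the real part
  bound keeps the root away from its branch cut and its modulus above 1, and the norm
  bound is that of the contraction of Bonnet's recurrence.
\<close>

definition kernel_small :: "complex \<Rightarrow> complex \<Rightarrow> bool" where
  "kernel_small x y \<longleftrightarrow> Re (kernel_den x y) > 1 \<and>
     norm ((x + y - 2 * x\<^sup>2 * y\<^sup>2) / kernel_den x y) + norm ((x - y)\<^sup>2 / kernel_den x y) < 1/4"

lemma eventually_kernel_small:
  "eventually (\<lambda>p. kernel_small (fst p) (snd p)) (nhds (1, 1))"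
proof -
  let ?D = "\<lambda>p. kernel_den (fst p) (snd p)"
  let ?N = "\<lambda>p. norm ((fst p + snd p - 2 * (fst p)\<^sup>2 * (snd p)\<^sup>2) / ?D p) + norm ((fst p - snd p)\<^sup>2 / ?D p)"
  have D: "isCont ?D (1, 1)" unfolding kernel_den_def by (intro continuous_intros)
  have D1: "?D (1, 1) = 9" by (simp add: kernel_den_def)
  have "(?D \<longlongrightarrow> ?D (1, 1)) (nhds (1, 1))"
    using D unfolding isCont_def by (rule tendsto_at_iff_tendsto_nhds[THEN iffD1])
  then have "(?D \<longlongrightarrow> 9) (nhds (1, 1))"
    unfolding D1 .
  then have "eventually (\<lambda>p. Re (?D p) > 1) (nhds (1, 1))"
    by (rule order_tendstoD(1)[OF tendsto_Re]) simp
  moreover have "isCont ?N (1, 1)"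
  proof (intro continuous_add continuous_norm isCont_divide D)
    show "isCont (\<lambda>p. fst p + snd p - 2 * (fst p)\<^sup>2 * (snd p)\<^sup>2) (1, 1 :: complex)"
      "isCont (\<lambda>p. (fst p - snd p)\<^sup>2) (1, 1 :: complex)"
      by (intro continuous_intros)+
    show "?D (1, 1) \<noteq> 0" "?D (1, 1) \<noteq> 0" unfolding D1 by simp_all
  qed
  then have "(?N \<longlongrightarrow> ?N (1, 1)) (nhds (1, 1))"
    unfolding isCont_def by (rule tendsto_at_iff_tendsto_nhds[THEN iffD1])
  then have "eventually (\<lambda>p. ?N p < 1/4) (nhds (1, 1))"
    by (rule order_tendstoD(2)) simp
  ultimately show ?thesis unfolding kernel_small_def by eventually_elim simp
qed

lemma norm_legendre_kernel_le:
  assumes "kernel_small x y"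
  shows "norm (legendre_kernel n x y) \<le> (1/2) ^ n"
proof -
  have "1 \<le> norm (kernel_den x y)"
    using assms complex_Re_le_cmod[of "kernel_den x y"] by (simp add: kernel_small_def)
  then have 1: "1 \<le> norm (csqrt (kernel_den x y))" by simp
  let ?h = "legendre_hom n ((x + y - 2 * x\<^sup>2 * y\<^sup>2) / kernel_den x y) ((x - y)\<^sup>2 / kernel_den x y)"
  have "norm (legendre_kernel n x y) = norm ?h / norm (csqrt (kernel_den x y))"
    by (simp add: legendre_kernel_def norm_divide)
  also have "\<dots> \<le> norm ?h / 1"
    using 1 by (intro divide_left_mono) auto
  also have "norm ?h / 1 = norm ?h" by simp
  also have "\<dots> \<le> (1/2) ^ n"
    by (rule norm_legendre_hom_le) (use assms in \<open>simp add: kernel_small_def\<close>)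
  finally show ?thesis .
qed

definition kernel_series :: "complex \<Rightarrow> complex \<Rightarrow> complex" where
  "kernel_series x y = (\<Sum>n. cubic_coeff n * legendre_kernel (3 * n) x y)"

lemma kernel_series_commute: "kernel_series x y = kernel_series y x"
  unfolding kernel_series_def by (subst legendre_kernel_commute) simp

lemma kernel_series_1_1: "kernel_series 1 1 = 1/3"
proof -
  have van: "legendre_hom (Suc n) 0 0 = 0" for n
    by (cases n) simp_all
  have 0: "legendre_kernel (3 * n) 1 1 = 0" if "n \<noteq> 0" for n
    using that van[of "3 * n - 1"] by (simp add: legendre_kernel_def)
  have "kernel_series 1 1 = (\<Sum>n\<in>{0}. cubic_coeff n * legendre_kernel (3 * n) 1 1)"
    unfolding kernel_series_def by (rule suminf_finite) (auto simp: 0)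
  also have "\<dots> = 1 / csqrt (of_real 9)"
    by (simp add: legendre_kernel_def kernel_den_def)
  also have "\<dots> = 1/3"
    by (subst csqrt_of_real_nonneg) (simp_all add: real_sqrt_unique[of 3])
  finally show ?thesis .
qed

lemma
  assumes S: "open S" and small: "\<And>x. x \<in> S \<Longrightarrow> kernel_small x y"
  shows holomorphic_kernel_series: "(\<lambda>x. kernel_series x y) holomorphic_on S"
    and cubic_op_kernel_series: "\<And>x. x \<in> S \<Longrightarrow> cubic_op (\<lambda>x. kernel_series x y) x = 0"
    and summable_kernel_series: "\<And>x. x \<in> S \<Longrightarrow> summable (\<lambda>n. cubic_coeff n * legendre_kernel (3 * n) x y)"
proof -
  let ?g = "\<lambda>n x. legendre_kernel (3 * n) x y"
  let ?k = "\<lambda>n x. legendre_kernel (3 * n - 1) x y"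
  have den: "Re (kernel_den x y) > 0" if "x \<in> S" for x
    using small[OF that] by (simp add: kernel_small_def)
  have hol: "?g n holomorphic_on S" for n by (rule holomorphic_legendre_kernel[OF den])
  have op: "cubic_op (?g n) x = 9 * (of_nat n)\<^sup>2 * ?k n x - (3 * of_nat n + 1) * (3 * of_nat n + 2) * ?k (Suc n) x"
    if "x \<in> S" for n x
    using cubic_op_legendre_kernel[OF S that den, of "3 * n"] by (simp add: power2_eq_square)
  have g: "norm (?g n x) \<le> 2 * (1/2) ^ n" if "x \<in> S" for n x
  proof -
    have "norm (?g n x) \<le> (1/2) ^ (3 * n)"
      by (rule norm_legendre_kernel_le[OF small[OF that]])
    also have "\<dots> \<le> (1/2) ^ n" by (rule power_decreasing) auto
    also have "\<dots> \<le> 2 * (1/2) ^ n" by simp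
    finally show ?thesis .
  qed
  have k: "norm (?k n x) \<le> 2 * (1/2) ^ n" if "x \<in> S" for n x
  proof -
    have "norm (?k n x) \<le> (1/2) ^ (3 * n - 1)"
      by (rule norm_legendre_kernel_le[OF small[OF that]])
    also have "\<dots> \<le> (1/2) ^ (n - 1)" by (rule power_decreasing) auto
    also have "\<dots> \<le> 2 * (1/2) ^ n" by (cases n) simp_all
    finally show ?thesis .
  qed
  show "(\<lambda>x. kernel_series x y) holomorphic_on S" "\<And>x. x \<in> S \<Longrightarrow> cubic_op (\<lambda>x. kernel_series x y) x = 0"
    "\<And>x. x \<in> S \<Longrightarrow> summable (\<lambda>n. cubic_coeff n * legendre_kernel (3 * n) x y)"
    unfolding kernel_series_def using cubic_op_series_eq_0[OF S hol op g k] by simp_all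
qed

text \<open>
  Everything required by the uniqueness of solutions holds on one bidisc around \<open>(1, 1)\<close>; it must
  not depend on the second variable, because the two variables are exchanged in the argument.
\<close>

lemma common_radius:
  obtains r :: real where "r > 0"
    and "\<And>x y. x \<in> ball 1 r \<Longrightarrow> y \<in> ball 1 r \<Longrightarrow> kernel_small x y"
    and "\<And>x :: complex. x \<in> ball 1 r \<Longrightarrow> norm (1 - x ^ 3) < 1/2"
    and "\<And>x. x \<in> ball 1 r \<Longrightarrow> cubic_fun x \<noteq> 0"
    and "\<And>x :: complex. x \<in> ball 1 r \<Longrightarrow> x \<noteq> 1 \<Longrightarrow> x * (1 - x ^ 3) \<noteq> 0"
proof -
  obtain d where d: "d > 0" "\<And>p. dist p (1, 1) < d \<Longrightarrow> kernel_small (fst p) (snd p)"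
    using eventually_kernel_small unfolding eventually_nhds_metric by blast
  let ?S = "{x :: complex. norm (1 - x ^ 3) < 1/2}"
  have "isCont cubic_fun 1"
    using holomorphic_on_imp_continuous_on[OF holomorphic_cubic_fun] open_cubic_domain
    by (simp add: continuous_on_eq_continuous_at)
  then have "eventually (\<lambda>x. cubic_fun x \<noteq> 0) (nhds 1)"
    unfolding isCont_def tendsto_at_iff_tendsto_nhds
    by (rule tendsto_imp_eventually_ne) (simp add: cubic_fun_1)
  moreover have "eventually (\<lambda>x. x \<in> ?S) (nhds 1)"
    by (rule eventually_nhds_in_open[OF open_cubic_domain]) simp
  ultimately have "eventually (\<lambda>x. cubic_fun x \<noteq> 0 \<and> x \<in> ?S) (nhds 1)"
    by (rule eventually_conj)
  then obtain e where e: "e > 0" "\<And>x. dist x 1 < e \<Longrightarrow> cubic_fun x \<noteq> 0 \<and> x \<in> ?S"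
    unfolding eventually_nhds_metric by blast
  define r where "r = min (d / 2) (min e (1/2))"
  show ?thesis
  proof
    show "r > 0" using d e by (simp add: r_def)
  next
    fix x :: complex assume x: "x \<in> ball 1 r"
    then have xe: "dist x 1 < e" by (simp add: r_def dist_commute)
    show "norm (1 - x ^ 3) < 1/2" "cubic_fun x \<noteq> 0" using e(2)[OF xe] by auto
    show "kernel_small x y" if y: "y \<in> ball 1 r" for y
    proof -
      have "dist (x, y) (1, 1) \<le> dist x 1 + dist y 1"
        unfolding dist_Pair_Pair by (rule sqrt_sum_squares_le_sum) auto
      also have "\<dots> < d / 2 + d / 2"
        using x y by (intro add_strict_mono) (auto simp: r_def dist_commute)
      finally show ?thesis using d(2)[of "(x, y)"] by simp
    qed
    show "x * (1 - x ^ 3) \<noteq> 0" if "x \<noteq> 1"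
    proof -
      \<comment> \<open>the other two cube roots of unity have real part -1/2 and are excluded by \<open>Re x > 1/2\<close>\<close>
      have "norm (x - 1) < 1/2" using x by (simp add: r_def dist_norm norm_minus_commute)
      then have Re: "Re x > 1/2" using abs_Re_le_cmod[of "x - 1"] by simp
      then have "x \<noteq> 0" by auto
      have "x\<^sup>2 + x + 1 \<noteq> 0"
      proof
        assume "x\<^sup>2 + x + 1 = 0"
        then have "Im x * (2 * Re x + 1) = 0" and *: "(Re x)\<^sup>2 - (Im x)\<^sup>2 + Re x + 1 = 0"
          by (auto simp: complex_eq_iff power2_eq_square algebra_simps)
        then have "Im x = 0" using Re by auto
        with * Re show False using zero_le_power2[of "Re x"] by simp
      qed
      moreover have "1 - x ^ 3 = (1 - x) * (x\<^sup>2 + x + 1)" by algebra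
      ultimately show ?thesis using \<open>x \<noteq> 0\<close> \<open>x \<noteq> 1\<close> by simp
    qed
  qed
qed

text \<open>
  As a function of \<open>x\<close> the series is a solution of the equation of \<open>cubic_fun\<close>, so it is
  its value at \<open>x = 1\<close> times \<open>cubic_fun x\<close>. By symmetry that value is treated in the same way as a
  function of \<open>y\<close>, and the constant \<open>1/3\<close> is the value at \<open>(1, 1)\<close>, where the root equals 3.
\<close>

lemma kernel_series_eq:
  assumes small: "\<And>x y. x \<in> ball 1 r \<Longrightarrow> y \<in> ball 1 r \<Longrightarrow> kernel_small x y"
    and half: "\<And>x :: complex. x \<in> ball 1 r \<Longrightarrow> norm (1 - x ^ 3) < 1/2"
    and nz: "\<And>x. x \<in> ball 1 r \<Longrightarrow> cubic_fun x \<noteq> 0"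
    and dom: "\<And>x :: complex. x \<in> ball 1 r \<Longrightarrow> x \<noteq> 1 \<Longrightarrow> x * (1 - x ^ 3) \<noteq> 0"
    and x: "x \<in> ball 1 r" and y: "y \<in> ball 1 r"
  shows "kernel_series x y = cubic_fun x * cubic_fun y / 3"
proof -
  have one: "(1 :: complex) \<in> ball 1 r"
    using x by (metis ball_eq_empty centre_in_ball empty_iff not_le)
  have hol: "cubic_fun holomorphic_on ball 1 r"
    by (rule holomorphic_on_subset[OF holomorphic_cubic_fun]) (use half in blast)
  have ode: "cubic_op cubic_fun x = 0" if "x \<in> ball 1 r" for x
    by (rule cubic_op_cubic_fun) (use half[OF that] in simp)
  have expand: "kernel_series u v = kernel_series 1 v * cubic_fun u"
    if u: "u \<in> ball 1 r" and v: "v \<in> ball 1 r" for u v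
  proof -
    have "cubic_fun 1 * kernel_series u v = kernel_series 1 v * cubic_fun u"
      by (rule cubic_op_unique[OF open_ball convex_ball one dom hol ode nz
            holomorphic_kernel_series[OF open_ball small[OF _ v]]
            cubic_op_kernel_series[OF open_ball small[OF _ v]] u])
    then show ?thesis by (simp add: cubic_fun_1)
  qed
  have "kernel_series x y = kernel_series y 1 * cubic_fun x"
    using expand[OF x y] kernel_series_commute[of 1 y] by simp
  also have "kernel_series y 1 = kernel_series 1 1 * cubic_fun y"
    by (rule expand[OF y one])
  finally show ?thesis by (simp add: kernel_series_1_1)
qed

lemma legendre_fun_minus_third:
  assumes "norm (1 - x ^ 3) < 1"
  shows "legendre_fun (- 1/3) (2 * x ^ 3 - 1) = cubic_fun x"
proof -
  have "(1 - (2 * x ^ 3 - 1)) / 2 = 1 - x ^ 3" "- (- 1/3) = (1/3 :: complex)" "- 1/3 + 1 = (2/3 :: complex)"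
    by (simp_all add: field_simps)
  with hyp2F1_eq_cubic_fun[OF assms] show ?thesis
    unfolding legendre_fun_def by (simp only:)
qed

lemma ferrers_fun_eq_legendre_fun: "ferrers_fun \<nu> t = legendre_fun \<nu> (complex_of_real t)"
  unfolding ferrers_fun_def legendre_fun_def ..

theorem theorem5:
  shows "\<exists>U :: real set. open U \<and> 1 \<in> U \<and>
    (\<forall>x\<in>U. \<forall>y\<in>U. (x = 1 \<and> y = 1) \<or> (x \<noteq> 1 \<and> y \<noteq> 1) \<longrightarrow>
      summable (\<lambda>n. pochhammer (1/3 :: complex) n * pochhammer (2/3) n / (fact n)\<^sup>2
                      * legendre_factor (3 * n) x y) \<and>
      3 * (\<Sum>n. pochhammer (1/3 :: complex) n * pochhammer (2/3) n / (fact n)\<^sup>2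
                  * legendre_factor (3 * n) x y) =
      complex_of_real (sqrt (1 + 4 * x * y * (x + y))) *
        (if x = 1 \<and> y = 1 then 1
         else if x > 1 \<and> y > 1 then
           legendre_fun (-1/3) (complex_of_real (2 * x ^ 3 - 1)) *
           legendre_fun (-1/3) (complex_of_real (2 * y ^ 3 - 1))
         else if x < 1 \<and> y > 1 then
           ferrers_fun (-1/3) (2 * x ^ 3 - 1) *
           legendre_fun (-1/3) (complex_of_real (2 * y ^ 3 - 1))
         else if x > 1 \<and> y < 1 then
           legendre_fun (-1/3) (complex_of_real (2 * x ^ 3 - 1)) *
           ferrers_fun (-1/3) (2 * y ^ 3 - 1)
         else
           ferrers_fun (-1/3) (2 * x ^ 3 - 1) *
           ferrers_fun (-1/3) (2 * y ^ 3 - 1)))"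
proof -
  obtain r :: real where r0: "r > 0"
    and r: "\<And>x y. x \<in> ball 1 r \<Longrightarrow> y \<in> ball 1 r \<Longrightarrow> kernel_small x y"
      "\<And>x :: complex. x \<in> ball 1 r \<Longrightarrow> norm (1 - x ^ 3) < 1/2"
      "\<And>x. x \<in> ball 1 r \<Longrightarrow> cubic_fun x \<noteq> 0"
      "\<And>x :: complex. x \<in> ball 1 r \<Longrightarrow> x \<noteq> 1 \<Longrightarrow> x * (1 - x ^ 3) \<noteq> 0"
    by (fact common_radius)
  have in_ball: "complex_of_real x \<in> ball 1 r" if "x \<in> ball 1 r" for x
    using that dist_of_real[of 1 x, where 'a = complex] by simp
  have leg: "legendre_fun (-1/3) (complex_of_real (2 * x ^ 3 - 1)) = cubic_fun x"
    and fer: "ferrers_fun (-1/3) (2 * x ^ 3 - 1) = cubic_fun x" if "x \<in> ball 1 r" for x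
  proof -
    have "norm (1 - complex_of_real x ^ 3) < 1" using r(2)[OF in_ball[OF that]] by simp
    moreover have "complex_of_real (2 * x ^ 3 - 1) = 2 * complex_of_real x ^ 3 - 1" by simp
    ultimately show "legendre_fun (-1/3) (complex_of_real (2 * x ^ 3 - 1)) = cubic_fun x"
      using legendre_fun_minus_third by (simp only:)
    then show "ferrers_fun (-1/3) (2 * x ^ 3 - 1) = cubic_fun x"
      by (simp only: ferrers_fun_eq_legendre_fun)
  qed
  show ?thesis
  proof (intro exI[of _ "ball 1 r"] conjI ballI impI)
    show "open (ball (1::real) r)" "(1::real) \<in> ball 1 r" using r0 by simp_all
    fix x y :: real assume x: "x \<in> ball 1 r" and y: "y \<in> ball 1 r"
    let ?D = "1 + 4 * x * y * (x + y)"
    let ?t = "\<lambda>n. cubic_coeff n * legendre_kernel (3 * n) (of_real x) (of_real y)"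
    have small: "kernel_small z (of_real y)" if "z \<in> ball 1 r" for z
      by (rule r(1)[OF that in_ball[OF y]])
    have D: "?D > 0"
      using small[OF in_ball[OF x]] by (simp add: kernel_small_def kernel_den_of_real del: of_real_add of_real_mult)
    have terms: "pochhammer (1/3 :: complex) n * pochhammer (2/3) n / (fact n)\<^sup>2 * legendre_factor (3 * n) x y
                   = of_real (sqrt ?D) * ?t n" for n
      unfolding legendre_factor_eq[OF D] cubic_coeff_def by (simp only: mult_ac)
    have sums: "summable ?t"
      by (rule summable_kernel_series[OF open_ball small in_ball[OF x]])
    show "summable (\<lambda>n. pochhammer (1/3 :: complex) n * pochhammer (2/3) n / (fact n)\<^sup>2
                      * legendre_factor (3 * n) x y)"
      unfolding terms by (rule summable_mult[OF sums])
    have "3 * (\<Sum>n. pochhammer (1/3 :: complex) n * pochhammer (2/3) n / (fact n)\<^sup>2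
                  * legendre_factor (3 * n) x y) = of_real (sqrt ?D) * (3 * kernel_series x y)"
      unfolding terms suminf_mult[OF sums] kernel_series_def by simp
    also have "3 * kernel_series x y = cubic_fun x * cubic_fun y"
      using kernel_series_eq[OF r in_ball[OF x] in_ball[OF y]] by (simp add: mult.commute)
    finally show "3 * (\<Sum>n. pochhammer (1/3 :: complex) n * pochhammer (2/3) n / (fact n)\<^sup>2
                  * legendre_factor (3 * n) x y) =
      complex_of_real (sqrt ?D) *
        (if x = 1 \<and> y = 1 then 1
         else if x > 1 \<and> y > 1 then
           legendre_fun (-1/3) (complex_of_real (2 * x ^ 3 - 1)) *
           legendre_fun (-1/3) (complex_of_real (2 * y ^ 3 - 1))
         else if x < 1 \<and> y > 1 then
           ferrers_fun (-1/3) (2 * x ^ 3 - 1) *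
           legendre_fun (-1/3) (complex_of_real (2 * y ^ 3 - 1))
         else if x > 1 \<and> y < 1 then
           legendre_fun (-1/3) (complex_of_real (2 * x ^ 3 - 1)) *
           ferrers_fun (-1/3) (2 * y ^ 3 - 1)
         else
           ferrers_fun (-1/3) (2 * x ^ 3 - 1) *
           ferrers_fun (-1/3) (2 * y ^ 3 - 1))"
      by (simp only: leg[OF x] leg[OF y] fer[OF x] fer[OF y]) (auto simp: cubic_fun_1)
  qed
qed

end
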